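(* Let $\varphi:\partial B_2\to\mathbb{R}^2$ be a continuous function. Then the function $\Phi=\mathcal{E}\varphi:\overline{B}_2\to\mathbb{R}^2$ is continuous on $\overline{B}_2$ and satisfies $\Phi|_{\partial B_2}=\varphi$.
   Context: $B_2$ is the open unit disk in $\mathbb{R}^2$ and $\partial B_2$ the unit circle. A function $\varphi$ on $\partial B_2$ is identified with the $2\pi$-periodic function on $\mathbb{R}$ given by $\theta\mapsto\varphi(\cos\theta,\sin\theta)$, again denoted $\varphi$. Let $\arccos:[-1,1]\to[0,\pi]$ be the usual inverse cosine and $\widetilde{\arccos}(x)=2\pi-\arccos(x)\in[\pi,2\pi]$. For $0\le r<1$ and $0\le\theta\le\pi$ put $$\psi_+(r,\theta)=\arccos\left(r\sin^2\theta+\cos\theta\sqrt{1-r^2\sin^2\theta}\right),\quad \psi_-(r,\theta)=\widetilde{\arccos}\left(r\sin^2\theta-\cos\theta\sqrt{1-r^2\sin^2\theta}\right).$$ For $0\le r<1$ and $0\le\theta\le2\pi$ define $\psi_*(r,\theta)=\psi_+(r,\theta)$ if $0\le\theta\le\pi$, and $\psi_*(r,\theta)=\psi_-(r,\theta-\pi)$ if $\pi<\theta\le 2\pi$. For $r=1$ define $\psi_*(1,\theta)=0$ if $0\le\theta\le\frac{1}{2}\pi$, $\psi_*(1,\theta)=2\theta-\pi$ if $\frac12\pi\le\theta\le\frac32\pi$, and $\psi_*(1,\theta)=2\pi$ if $\frac32\pi\le\theta\le2\pi$. For $0\le r<1$ and $0\le\theta\le2\pi$ define $$k(r,\theta)=1+\frac{r\cos\theta}{\sqrt{1-r^2\sin^2\theta}},$$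 and for $r=1$ define $k(1,\theta)=2$ if $0\le\theta<\frac12\pi$, $k(1,\theta)=0$ if $\frac12\pi\le\theta\le\frac32\pi$, and $k(1,\theta)=2$ if $\frac32\pi<\theta\le2\pi$. The extension operator $\mathcal{E}$ is defined, for $P=r(\cos\alpha,\sin\alpha)\in\overline{B}_2$ with $r\in[0,1]$, $\alpha\in[0,2\pi)$, by $$(\mathcal{E}\varphi)(P)=\frac{1}{2\pi}\int_0^{2\pi}k(r,\theta)\,\varphi(\psi_*(r,\theta)+\alpha)\,d\theta$$ (for $P=0$ the value does not depend on $\alpha$). *)

theory Defs
  imports "HOL-Analysis.Analysis"
begin

definition circle_pt :: "real \<Rightarrow> real ^ 2" where
  "circle_pt \<theta> = vector [cos \<theta>, sin \<theta>]"

definition arccos_tilde :: "real \<Rightarrow> real" where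
  "arccos_tilde x = 2 * pi - arccos x"

definition psi_plus :: "real \<Rightarrow> real \<Rightarrow> real" where
  "psi_plus r \<theta> =
     arccos (r * (sin \<theta>)\<^sup>2 + cos \<theta> * sqrt (1 - r\<^sup>2 * (sin \<theta>)\<^sup>2))"

definition psi_minus :: "real \<Rightarrow> real \<Rightarrow> real" where
  "psi_minus r \<theta> =
     arccos_tilde (r * (sin \<theta>)\<^sup>2 - cos \<theta> * sqrt (1 - r\<^sup>2 * (sin \<theta>)\<^sup>2))"

text \<open>
  The functions below are meaningful for radii in [0,1] and angles in
  [0, 2 pi]; the final branches are the case of radius 1.
\<close>

definition psi_star :: "real \<Rightarrow> real \<Rightarrow> real" where
  "psi_star r \<theta> =
     (if r < 1 then
        (if \<theta> \<le> pi then psi_plus r \<theta> else psi_minus r (\<theta> - pi))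
      else
        (if \<theta> \<le> pi / 2 then 0
         else if \<theta> \<le> 3 * pi / 2 then 2 * \<theta> - pi
         else 2 * pi))"

definition kernel_k :: "real \<Rightarrow> real \<Rightarrow> real" where
  "kernel_k r \<theta> =
     (if r < 1 then 1 + r * cos \<theta> / sqrt (1 - r\<^sup>2 * (sin \<theta>)\<^sup>2)
      else (if pi / 2 \<le> \<theta> \<and> \<theta> \<le> 3 * pi / 2 then 0 else 2))"

definition polar_angle :: "real ^ 2 \<Rightarrow> real" where
  "polar_angle P =
     (SOME \<alpha>. 0 \<le> \<alpha> \<and> \<alpha> < 2 * pi \<and> P = norm P *\<^sub>R circle_pt \<alpha>)"

definition ext_op :: "(real ^ 2 \<Rightarrow> real ^ 2) \<Rightarrow> real ^ 2 \<Rightarrow> real ^ 2" where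
  "ext_op \<phi> P =
     (1 / (2 * pi)) *\<^sub>R
       integral {0..2 * pi}
         (\<lambda>\<theta>. kernel_k (norm P) \<theta> *\<^sub>R
              \<phi> (circle_pt (psi_star (norm P) \<theta> + polar_angle P)))"

text \<open>
  The angle of the origin is an arbitrary choice; the lemmas below show that
  the choice is immaterial, so that the operator is given by its defining
  formula for every polar representation of a point, including the origin.
\<close>

lemma norm_circle_pt: "norm (circle_pt \<theta>) = 1"
  by (simp add: circle_pt_def norm_vec_def L2_set_def sum_2)

lemma circle_pt_add_2pi: "circle_pt (\<theta> + 2 * pi) = circle_pt \<theta>"
  by (simp add: circle_pt_def)

lemma circle_pt_inj:
  assumes "0 \<le> \<alpha>" "\<alpha> < 2 * pi" "0 \<le> \<beta>" "\<beta> < 2 * pi" "circle_pt \<alpha> = circle_pt \<beta>"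
  shows "\<alpha> = \<beta>"
proof -
  have "circle_pt \<alpha> $ i = circle_pt \<beta> $ i" for i using assms(5) by simp
  from this[of 1] this[of 2] have "cos \<alpha> = cos \<beta>" "sin \<alpha> = sin \<beta>"
    by (simp_all add: circle_pt_def)
  then obtain n :: int where n: "\<alpha> = \<beta> + 2 * pi * n"
    using sin_cos_eq_iff[of \<alpha> \<beta>] by auto
  have "2 * pi * real_of_int n < 2 * pi * 1" "2 * pi * (- 1) < 2 * pi * real_of_int n"
    using assms(1-4) n by linarith+
  then have "real_of_int n < 1" "- 1 < real_of_int n"
    by (simp_all only: mult_less_cancel_left_pos[of "2 * pi"] pi_gt_zero
                       zero_less_mult_iff zero_less_numeral simp_thms)
  then have "n = 0" by linarith
  with n show ?thesis by simp
qed

lemma polar_angle_eq: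
  assumes "0 < r" "0 \<le> \<alpha>" "\<alpha> < 2 * pi"
  shows "polar_angle (r *\<^sub>R circle_pt \<alpha>) = \<alpha>"
  unfolding polar_angle_def
proof (rule some_equality)
  show "0 \<le> \<alpha> \<and> \<alpha> < 2 * pi \<and>
        r *\<^sub>R circle_pt \<alpha> = norm (r *\<^sub>R circle_pt \<alpha>) *\<^sub>R circle_pt \<alpha>"
    using assms by (simp add: norm_circle_pt)
next
  fix \<beta> assume *: "0 \<le> \<beta> \<and> \<beta> < 2 * pi \<and>
        r *\<^sub>R circle_pt \<alpha> = norm (r *\<^sub>R circle_pt \<alpha>) *\<^sub>R circle_pt \<beta>"
  with assms(1) have "circle_pt \<beta> = circle_pt \<alpha>"
    by (simp add: norm_circle_pt)
  with * assms show "\<beta> = \<alpha>" by (intro circle_pt_inj) auto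
qed

lemma psi_star_0:
  assumes "0 \<le> \<theta>" "\<theta> \<le> 2 * pi"
  shows "psi_star 0 \<theta> = \<theta>"
proof (cases "\<theta> \<le> pi")
  case True
  then show ?thesis using assms by (simp add: psi_star_def psi_plus_def arccos_cos)
next
  case False
  have "arccos (cos (2 * pi - \<theta>)) = 2 * pi - \<theta>"
    using assms False by (intro arccos_cos) auto
  moreover have "- cos (\<theta> - pi) = cos (2 * pi - \<theta>)"
    by (simp add: cos_diff)
  ultimately show ?thesis using False
    by (simp add: psi_star_def psi_minus_def arccos_tilde_def)
qed

lemma integral_circle_pt_shift:
  fixes \<phi> :: "real ^ 2 \<Rightarrow> real ^ 2"
  assumes cont: "continuous_on (sphere 0 1) \<phi>" and "0 \<le> \<alpha>" "\<alpha> \<le> 2 * pi"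
  shows "integral {0..2 * pi} (\<lambda>\<theta>. \<phi> (circle_pt (\<theta> + \<alpha>))) =
         integral {0..2 * pi} (\<lambda>\<theta>. \<phi> (circle_pt \<theta>))"
proof -
  let ?f = "\<lambda>\<theta>. \<phi> (circle_pt \<theta>)"
  have c: "continuous_on S circle_pt" for S
  proof -
    have eq: "circle_pt = (\<lambda>\<theta>. \<chi> i. if i = 1 then cos \<theta> else sin \<theta>)"
      by (auto simp: circle_pt_def vec_eq_iff forall_2)
    have "continuous_on S (\<lambda>\<theta>. if i = 1 then cos \<theta> else sin \<theta>)" for i :: 2
      by (cases "i = 1") (auto intro!: continuous_intros)
    then show ?thesis unfolding eq by (rule continuous_on_vec_lambda)
  qed
  have f: "continuous_on S ?f" for S
    by (rule continuous_on_compose2[OF cont c]) (auto simp: norm_circle_pt)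
  have i: "?f integrable_on {a..b}" for a b
    by (intro integrable_continuous_real f)
  have shift: "integral {a..b} (\<lambda>\<theta>. ?f (\<theta> + c)) = integral {a + c..b + c} ?f" for a b c
    using integral_shift[of a c b ?f] f by (simp add: o_def)
  have "integral {0..2 * pi} (\<lambda>\<theta>. ?f (\<theta> + \<alpha>)) = integral {\<alpha>..2 * pi + \<alpha>} ?f"
    using shift[of 0 "2 * pi" \<alpha>] by simp
  also have "\<dots> = integral {\<alpha>..2 * pi} ?f + integral {2 * pi..2 * pi + \<alpha>} ?f"
    using assms by (intro Henstock_Kurzweil_Integration.integral_combine[symmetric] i) auto
  also have "integral {2 * pi..2 * pi + \<alpha>} ?f = integral {0..\<alpha>} ?f"
    using shift[of 0 "\<alpha>" "2 * pi"] by (simp add: circle_pt_add_2pi add.commute)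
  also have "integral {\<alpha>..2 * pi} ?f + integral {0..\<alpha>} ?f = integral {0..2 * pi} ?f"
    using assms Henstock_Kurzweil_Integration.integral_combine[of 0 \<alpha> "2 * pi" ?f] i
    by (simp add: add.commute)
  finally show ?thesis .
qed

lemma polar_angle_bounds_0: "0 \<le> polar_angle 0" "polar_angle 0 < 2 * pi"
proof -
  have "0 \<le> polar_angle 0 \<and> polar_angle 0 < 2 * pi \<and>
        (0 :: real ^ 2) = norm (0 :: real ^ 2) *\<^sub>R circle_pt (polar_angle 0)"
    unfolding polar_angle_def by (rule someI[of _ 0]) simp
  then show "0 \<le> polar_angle 0" "polar_angle 0 < 2 * pi" by auto
qed

lemma ext_op_polar:
  fixes \<phi> :: "real ^ 2 \<Rightarrow> real ^ 2"
  assumes "continuous_on (sphere 0 1) \<phi>"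
    and "0 \<le> r" "r \<le> 1" "0 \<le> \<alpha>" "\<alpha> < 2 * pi"
  shows "ext_op \<phi> (r *\<^sub>R circle_pt \<alpha>) =
         (1 / (2 * pi)) *\<^sub>R
           integral {0..2 * pi}
             (\<lambda>\<theta>. kernel_k r \<theta> *\<^sub>R \<phi> (circle_pt (psi_star r \<theta> + \<alpha>)))"
proof (cases "r = 0")
  case False
  with assms show ?thesis
    by (simp add: ext_op_def polar_angle_eq norm_circle_pt)
next
  case True
  have *: "integral {0..2 * pi}
             (\<lambda>\<theta>. kernel_k 0 \<theta> *\<^sub>R \<phi> (circle_pt (psi_star 0 \<theta> + \<beta>))) =
           integral {0..2 * pi} (\<lambda>\<theta>. \<phi> (circle_pt \<theta>))"
    if "0 \<le> \<beta>" "\<beta> < 2 * pi" for \<beta>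
  proof -
    have "integral {0..2 * pi}
             (\<lambda>\<theta>. kernel_k 0 \<theta> *\<^sub>R \<phi> (circle_pt (psi_star 0 \<theta> + \<beta>))) =
          integral {0..2 * pi} (\<lambda>\<theta>. \<phi> (circle_pt (\<theta> + \<beta>)))"
      by (intro integral_cong) (simp add: psi_star_0 kernel_k_def)
    with integral_circle_pt_shift[OF assms(1), of \<beta>] that show ?thesis by simp
  qed
  show ?thesis
    using True *[OF polar_angle_bounds_0] *[OF assms(4,5)]
    by (simp add: ext_op_def)
qed

end

theory Submission
  imports Defs
begin

text \<open>
  Write \<open>e\<close> for the unit vector at angle \<open>\<beta>\<close>. The ray from a point \<open>P\<close> of the closed disk in
  direction \<open>e\<close> leaves the disk at \<open>P + (S - P \<bullet> e) e\<close>, where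
  \<open>S = sqrt (1 - |P|^2 + (P \<bullet> e)^2)\<close> is half the length of the chord through \<open>P\<close> parallel
  to \<open>e\<close>. The formulas for \<open>\<psi>\<^sub>*\<close> and \<open>k\<close> are this geometry written out for \<open>P\<close> on the
  positive first axis: \<open>\<psi>\<^sub>*(r,\<theta>)\<close> is the angle of the exit point and
  \<open>k(r,\<theta>) = 1 + (P \<bullet> e) / S\<close>. Turning the picture by the polar angle of \<open>P\<close> and using
  periodicity of the integrand gives the coordinate-free form
  (\<open>ext_op_eq_chord_integral\<close>)

  \<open>(E \<phi>)(P) = 1/(2 pi) \<integral> (1 + (P \<bullet> e) / S) \<phi>(P + (S - P \<bullet> e) e) d\<beta>\<close>,

  in which the polar angle, and with it its jump and its ambiguity at the origin, is gone.

  For \<open>|P| = 1\<close> one has \<open>S = |P \<bullet> e|\<close>. Outward directions have weight 2 and exit point \<open>P\<close>,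
  inward directions have weight 0, so the integrand is \<open>(1 + sgn (P \<bullet> e)) \<phi>(P)\<close>; the sign
  integrates to zero because it is reversed by a half turn. This is the boundary identity.

  For continuity, the integrand depends continuously on \<open>P\<close> wherever \<open>S\<close> is nonzero, and \<open>S\<close>
  vanishes only for tangential directions at boundary points, a null set of angles. Since
  \<open>|P \<bullet> e| \<le> S\<close>, the weight is bounded by 2, and \<open>\<phi>\<close> is bounded by compactness, so dominated
  convergence applies.
\<close>

section \<open>Chords of the unit disk\<close>

definition half_chord :: "real ^ 2 \<Rightarrow> real \<Rightarrow> real" where
  "half_chord P \<beta> = sqrt (1 - (norm P)\<^sup>2 + (P \<bullet> circle_pt \<beta>)\<^sup>2)"

definition exit_point :: "real ^ 2 \<Rightarrow> real \<Rightarrow> real ^ 2" where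
  "exit_point P \<beta> = P + (half_chord P \<beta> - P \<bullet> circle_pt \<beta>) *\<^sub>R circle_pt \<beta>"

definition exit_weight :: "real ^ 2 \<Rightarrow> real \<Rightarrow> real" where
  "exit_weight P \<beta> = 1 + (P \<bullet> circle_pt \<beta>) / half_chord P \<beta>"

lemma circle_pt_components [simp]:
  "circle_pt \<theta> $ 1 = cos \<theta>" "circle_pt \<theta> $ 2 = sin \<theta>"
  by (simp_all add: circle_pt_def)

lemma inner_circle_pt: "P \<bullet> circle_pt \<beta> = P $ 1 * cos \<beta> + P $ 2 * sin \<beta>"
  by (simp add: inner_vec_def sum_2)

lemma inner_circle_pt_circle_pt: "circle_pt \<alpha> \<bullet> circle_pt \<beta> = cos (\<beta> - \<alpha>)"
  by (simp add: inner_circle_pt cos_diff mult.commute)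

lemma continuous_on_circle_pt: "continuous_on S circle_pt"
proof -
  have eq: "circle_pt = (\<lambda>\<theta>. \<chi> i. if i = 1 then cos \<theta> else sin \<theta>)"
    by (auto simp: vec_eq_iff forall_2)
  have "continuous_on S (\<lambda>\<theta>. if i = 1 then cos \<theta> else sin \<theta>)" for i :: 2
    by (cases "i = 1") (auto intro!: continuous_intros)
  then show ?thesis unfolding eq by (rule continuous_on_vec_lambda)
qed

lemma abs_inner_le_half_chord:
  assumes "norm P \<le> 1"
  shows "\<bar>P \<bullet> circle_pt \<beta>\<bar> \<le> half_chord P \<beta>"
  unfolding half_chord_def
  by (rule real_le_rsqrt) (use assms in \<open>simp add: power_le_one\<close>)

text \<open>
  With \<open>S\<close> the half chord and \<open>c = P \<bullet> e\<close>, the squared norm is \<open>|P|^2 + (S - c)(S + c)\<close>, and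
  \<open>S^2 - c^2 = 1 - |P|^2\<close> by the choice of \<open>S\<close>.
\<close>

lemma norm_exit_point:
  assumes "norm P \<le> 1"
  shows "norm (exit_point P \<beta>) = 1"
proof -
  let ?c = "P \<bullet> circle_pt \<beta>" and ?s = "half_chord P \<beta>"
  have s2: "?s\<^sup>2 = 1 - (norm P)\<^sup>2 + ?c\<^sup>2"
    unfolding half_chord_def using assms by (intro real_sqrt_pow2) (simp add: power_le_one)
  have expand: "(norm (P + t *\<^sub>R circle_pt \<beta>))\<^sup>2 = (norm P)\<^sup>2 + 2 * t * ?c + t\<^sup>2" for t
  proof -
    have "(norm (P + t *\<^sub>R circle_pt \<beta>))\<^sup>2
        = (norm P)\<^sup>2 + 2 * (P \<bullet> (t *\<^sub>R circle_pt \<beta>)) + (norm (t *\<^sub>R circle_pt \<beta>))\<^sup>2"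
      by (simp only: power2_norm_eq_inner inner_add_left inner_add_right
          inner_commute[of "t *\<^sub>R circle_pt \<beta>" P])
    then show ?thesis by (simp add: norm_circle_pt)
  qed
  have "(norm (exit_point P \<beta>))\<^sup>2 = (norm P)\<^sup>2 + 2 * (?s - ?c) * ?c + (?s - ?c)\<^sup>2"
    unfolding exit_point_def by (rule expand)
  also have "\<dots> = (norm P)\<^sup>2 + ?s\<^sup>2 - ?c\<^sup>2"
    by (simp add: power2_eq_square algebra_simps)
  finally have "(norm (exit_point P \<beta>))\<^sup>2 = 1" using s2 by simp
  then have "(norm (exit_point P \<beta>))\<^sup>2 = 1\<^sup>2" by simp
  then show ?thesis by (rule power2_eq_imp_eq) auto
qed

lemma exit_weight_abs_le:
  assumes "norm P \<le> 1"
  shows "\<bar>exit_weight P \<beta>\<bar> \<le> 2"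
proof -
  have "\<bar>(P \<bullet> circle_pt \<beta>) / half_chord P \<beta>\<bar> \<le> 1"
    using abs_inner_le_half_chord[OF assms, of \<beta>]
    by (cases "half_chord P \<beta> = 0") (auto simp: abs_divide divide_le_eq_1)
  then show ?thesis unfolding exit_weight_def by linarith
qed

section \<open>The chord form of the extension operator\<close>

text \<open>
  The argument of both arc cosines is the first coordinate of the exit point of the ray from
  \<open>(r, 0)\<close> at angle \<open>\<theta>\<close>. The second coordinate is then determined up to sign; as the ray has
  nonnegative length, its sign is that of \<open>sin \<theta>\<close>, which is what the choice between the two
  branches \<open>arccos\<close> and \<open>2 * pi - arccos\<close> encodes. At \<open>r = 1\<close> the length is
  \<open>\<bar>cos \<theta>\<bar> - cos \<theta>\<close>, and the double angle formulas give the stated value.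
\<close>

lemma cos_sin_psi_star:
  assumes "0 \<le> r" "r \<le> 1" "0 \<le> \<theta>" "\<theta> \<le> 2 * pi"
  defines "t \<equiv> sqrt (1 - r\<^sup>2 * (sin \<theta>)\<^sup>2) - r * cos \<theta>"
  shows "cos (psi_star r \<theta>) = r + t * cos \<theta>" "sin (psi_star r \<theta>) = t * sin \<theta>"
proof -
  let ?s = "sqrt (1 - r\<^sup>2 * (sin \<theta>)\<^sup>2)" and ?X = "r + t * cos \<theta>"
  have r2: "r\<^sup>2 \<le> 1" using assms(1,2) by (simp add: power_le_one)
  have "r\<^sup>2 * (sin \<theta>)\<^sup>2 \<le> 1 * 1"
    using r2 by (intro mult_mono) (auto simp: abs_square_le_1)
  then have s2: "?s\<^sup>2 = 1 - r\<^sup>2 * (sin \<theta>)\<^sup>2" by simp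
  have sc: "(sin \<theta>)\<^sup>2 = 1 - (cos \<theta>)\<^sup>2" by (simp add: sin_squared_eq)
  have "r * cos \<theta> \<le> ?s"
    by (rule real_le_rsqrt) (use r2 in \<open>simp add: sc power_mult_distrib algebra_simps\<close>)
  then have t: "0 \<le> t" by (simp add: t_def)
  have X: "r * (sin \<theta>)\<^sup>2 + cos \<theta> * ?s = ?X"
  proof -
    have "r * (sin \<theta>)\<^sup>2 + cos \<theta> * (t + r * cos \<theta>) = ?X"
      unfolding sc by (simp add: power2_eq_square algebra_simps)
    then show ?thesis by (simp add: t_def)
  qed
  have unit: "?X\<^sup>2 + (t * sin \<theta>)\<^sup>2 = 1"
  proof -
    have "?X\<^sup>2 + (t * sin \<theta>)\<^sup>2 = r\<^sup>2 + 2 * r * cos \<theta> * t + t\<^sup>2"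
      unfolding power_mult_distrib sc by (simp add: power2_eq_square algebra_simps)
    also have "\<dots> = r\<^sup>2 + (t + r * cos \<theta>)\<^sup>2 - r\<^sup>2 * (cos \<theta>)\<^sup>2"
      by (simp add: power2_eq_square algebra_simps)
    also have "t + r * cos \<theta> = ?s" by (simp add: t_def)
    finally show ?thesis unfolding s2 by (simp add: sc algebra_simps)
  qed
  have "?X\<^sup>2 \<le> 1" using unit zero_le_power2[of "t * sin \<theta>"] by linarith
  then have abs: "\<bar>?X\<bar> \<le> 1" by (simp add: abs_square_le_1)
  have root: "sqrt (1 - ?X\<^sup>2) = \<bar>t * sin \<theta>\<bar>"
    using unit by (metis add_diff_cancel_left' real_sqrt_abs)
  have cos_arccos: "cos (arccos ?X) = ?X" using abs by (intro cos_arccos_abs)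
  have sin_arccos: "sin (arccos ?X) = \<bar>t * sin \<theta>\<bar>"
    using abs root by (simp add: sin_arccos_abs)
  have "cos (psi_star r \<theta>) = ?X \<and> sin (psi_star r \<theta>) = t * sin \<theta>"
  proof (cases "r < 1")
    case True
    show ?thesis
    proof (cases "\<theta> \<le> pi")
      case True
      then have "0 \<le> sin \<theta>" using assms by (intro sin_ge_zero)
      then show ?thesis
        using \<open>r < 1\<close> True t cos_arccos sin_arccos
        by (simp add: psi_star_def psi_plus_def X)
    next
      case False
      then have "sin \<theta> \<le> 0" using assms sin_le_zero[of \<theta>] by (cases "\<theta> = 2 * pi") auto
      then have neg: "\<bar>t * sin \<theta>\<bar> = - (t * sin \<theta>)"
        using t by (simp add: mult_nonneg_nonpos)
      have "psi_star r \<theta> = 2 * pi - arccos ?X"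
        using \<open>r < 1\<close> False X
        by (simp add: psi_star_def psi_minus_def arccos_tilde_def)
      then show ?thesis using cos_arccos sin_arccos neg
        by (simp add: cos_diff sin_diff)
    qed
  next
    case False
    then have r: "r = 1" using assms by simp
    then have t: "t = \<bar>cos \<theta>\<bar> - cos \<theta>"
      by (simp add: t_def cos_squared_eq[symmetric])
    consider "\<theta> \<le> pi / 2" | "pi / 2 < \<theta>" "\<theta> \<le> 3 * pi / 2" | "3 * pi / 2 < \<theta>"
      by linarith
    then show ?thesis
    proof cases
      case 1
      then have "0 \<le> cos \<theta>" using assms by (intro cos_ge_zero) auto
      then show ?thesis using 1 r t by (simp add: psi_star_def)
    next
      case 2
      have "0 \<le> cos (\<theta> - pi)" using 2 by (intro cos_ge_zero) auto
      then have "t = - 2 * cos \<theta>" using t by (simp add: cos_diff)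
      then show ?thesis using 2 r
        by (simp add: psi_star_def cos_diff sin_diff cos_double_cos sin_double power2_eq_square)
    next
      case 3
      have "0 \<le> cos (2 * pi - \<theta>)" using 3 assms by (intro cos_ge_zero) auto
      then show ?thesis using 3 r t by (simp add: psi_star_def cos_diff)
    qed
  qed
  then show "cos (psi_star r \<theta>) = ?X" "sin (psi_star r \<theta>) = t * sin \<theta>" by auto
qed

text \<open>
  At \<open>r = 1\<close> the quotient is \<open>cos \<theta> / \<bar>cos \<theta>\<bar>\<close>, a sign. At the two tangential angles it reads
  \<open>0 / 0 = 0\<close> and the formula gives 1 instead of the prescribed 0, whence the last hypothesis.
\<close>

lemma kernel_k_eq:
  assumes "0 \<le> r" "r \<le> 1" "0 \<le> \<theta>" "\<theta> \<le> 2 * pi" "cos \<theta> \<noteq> 0"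
  shows "kernel_k r \<theta> = 1 + r * cos \<theta> / sqrt (1 - r\<^sup>2 * (sin \<theta>)\<^sup>2)"
proof (cases "r < 1")
  case False
  then have r: "r = 1" using assms by simp
  have s: "sqrt (1 - r\<^sup>2 * (sin \<theta>)\<^sup>2) = \<bar>cos \<theta>\<bar>"
    by (simp add: r cos_squared_eq[symmetric])
  consider "\<theta> < pi / 2" | "pi / 2 \<le> \<theta>" "\<theta> \<le> 3 * pi / 2" | "3 * pi / 2 < \<theta>"
    by linarith
  then show ?thesis
  proof cases
    case 1
    then have "0 \<le> cos \<theta>" using assms by (intro cos_ge_zero) auto
    then show ?thesis unfolding s using 1 r assms(5) by (simp add: kernel_k_def)
  next
    case 2
    have "0 \<le> cos (\<theta> - pi)" using 2 by (intro cos_ge_zero) auto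
    then have "cos \<theta> < 0" using assms(5) by (simp add: cos_diff)
    then show ?thesis unfolding s using 2 r by (simp add: kernel_k_def)
  next
    case 3
    have "0 \<le> cos (2 * pi - \<theta>)" using 3 assms by (intro cos_ge_zero) auto
    then show ?thesis unfolding s using 3 r assms(5) by (simp add: kernel_k_def cos_diff)
  qed
qed (simp add: kernel_k_def)

lemma half_chord_polar:
  assumes "0 \<le> r"
  shows "half_chord (r *\<^sub>R circle_pt \<alpha>) (\<theta> + \<alpha>) = sqrt (1 - r\<^sup>2 * (sin \<theta>)\<^sup>2)"
  using assms
  by (simp add: half_chord_def norm_circle_pt inner_circle_pt_circle_pt power_mult_distrib
      sin_squared_eq algebra_simps)

lemma exit_point_polar:
  assumes "0 \<le> r" "r \<le> 1" "0 \<le> \<theta>" "\<theta> \<le> 2 * pi"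
  shows "circle_pt (psi_star r \<theta> + \<alpha>) = exit_point (r *\<^sub>R circle_pt \<alpha>) (\<theta> + \<alpha>)"
proof -
  define t where "t = sqrt (1 - r\<^sup>2 * (sin \<theta>)\<^sup>2) - r * cos \<theta>"
  have hit: "cos (psi_star r \<theta>) = r + t * cos \<theta>" "sin (psi_star r \<theta>) = t * sin \<theta>"
    unfolding t_def by (rule cos_sin_psi_star[OF assms])+
  have "exit_point (r *\<^sub>R circle_pt \<alpha>) (\<theta> + \<alpha>) = r *\<^sub>R circle_pt \<alpha> + t *\<^sub>R circle_pt (\<theta> + \<alpha>)"
    by (simp add: exit_point_def half_chord_polar[OF assms(1)] inner_circle_pt_circle_pt t_def)
  then show ?thesis
    by (simp add: vec_eq_iff forall_2 cos_add sin_add hit algebra_simps)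
qed

lemma exit_weight_polar:
  assumes "0 \<le> r" "r \<le> 1" "0 \<le> \<theta>" "\<theta> \<le> 2 * pi" "cos \<theta> \<noteq> 0"
  shows "kernel_k r \<theta> = exit_weight (r *\<^sub>R circle_pt \<alpha>) (\<theta> + \<alpha>)"
  using kernel_k_eq[OF assms] half_chord_polar[OF assms(1), of \<alpha> \<theta>]
  by (simp add: exit_weight_def inner_circle_pt_circle_pt)

text \<open>
  These properties hold at the origin too, whatever angle is chosen there, so that the origin
  needs no separate treatment below.
\<close>

lemma polar_angle_spec:
  "0 \<le> polar_angle P" "polar_angle P < 2 * pi" "P = norm P *\<^sub>R circle_pt (polar_angle P)"
proof -
  have "\<exists>\<alpha>. 0 \<le> \<alpha> \<and> \<alpha> < 2 * pi \<and> P = norm P *\<^sub>R circle_pt \<alpha>"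
  proof (cases "P = 0")
    case True
    then show ?thesis by (intro exI[of _ 0]) simp
  next
    case False
    have n: "(norm P)\<^sup>2 = (P $ 1)\<^sup>2 + (P $ 2)\<^sup>2"
      unfolding power2_norm_eq_inner by (simp add: inner_vec_def sum_2 power2_eq_square)
    have "(P $ 1 / norm P)\<^sup>2 + (P $ 2 / norm P)\<^sup>2 = 1"
      using False by (simp add: power_divide add_divide_distrib[symmetric] n[symmetric])
    then obtain t where "0 \<le> t" "t < 2 * pi" "P $ 1 / norm P = cos t" "P $ 2 / norm P = sin t"
      by (rule sincos_total_2pi)
    moreover from this have "P $ 1 = norm P * cos t" "P $ 2 = norm P * sin t"
      using False by (simp_all add: divide_eq_eq mult.commute)
    then have "P = norm P *\<^sub>R circle_pt t"
      unfolding vec_eq_iff forall_2 vector_scaleR_component circle_pt_components real_scaleR_def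
      by blast
    ultimately show ?thesis by blast
  qed
  from someI_ex[OF this, folded polar_angle_def]
  show "0 \<le> polar_angle P" "polar_angle P < 2 * pi" "P = norm P *\<^sub>R circle_pt (polar_angle P)"
    by auto
qed

lemma integral_periodic_shift:
  fixes f :: "real \<Rightarrow> 'a::euclidean_space"
  assumes int: "\<And>a b. f integrable_on {a..b}"
    and per: "\<And>x. f (x + p) = f x" and c: "0 \<le> c" "c \<le> p"
  shows "integral {0..p} (\<lambda>x. f (x + c)) = integral {0..p} f"
proof -
  have shift: "integral {a..b} (\<lambda>x. f (x + d)) = integral {a + d..b + d} f" for a b d
    using integral_shift_real_ivl[of "a + d" d "b + d" f] by simp
  have "integral {0..p} (\<lambda>x. f (x + c)) = integral {c..p + c} f"
    using shift[of 0 p c] by simp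
  also have "\<dots> = integral {c..p} f + integral {p..p + c} f"
    using c by (intro Henstock_Kurzweil_Integration.integral_combine[symmetric] int) auto
  also have "integral {p..p + c} f = integral {0..c} f"
    using shift[of 0 c p] by (simp add: per add.commute)
  also have "integral {c..p} f + integral {0..c} f = integral {0..p} f"
    using c Henstock_Kurzweil_Integration.integral_combine[of 0 c p f] int
    by (simp add: add.commute)
  finally show ?thesis .
qed

definition chord_integrand :: "(real ^ 2 \<Rightarrow> real ^ 2) \<Rightarrow> real ^ 2 \<Rightarrow> real \<Rightarrow> real ^ 2" where
  "chord_integrand \<phi> P \<beta> = exit_weight P \<beta> *\<^sub>R \<phi> (exit_point P \<beta>)"

lemma countable_cos_zero: "countable {x. cos (x - \<alpha>) = (0 :: real)}"
proof -
  have "{x. cos (x - \<alpha>) = 0} \<subseteq> range (\<lambda>n::int. n * pi + pi / 2 + \<alpha>)"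
  proof
    fix x assume "x \<in> {x. cos (x - \<alpha>) = 0}"
    then obtain n :: int where "x - \<alpha> = n * pi + pi / 2"
      by (auto simp only: mem_Collect_eq cos_zero_iff_int2)
    then have "x = n * pi + pi / 2 + \<alpha>" by linarith
    then show "x \<in> range (\<lambda>n::int. n * pi + pi / 2 + \<alpha>)" by (rule range_eqI)
  qed
  then show ?thesis by (rule countable_subset) simp
qed

lemma negligible_cos_zero: "negligible {x. cos (x - \<alpha>) = (0 :: real)}"
  using countable_cos_zero
  by (simp add: negligible_iff_null_sets countable_imp_null_set_lborel null_sets_completionI)

lemma continuous_on_half_chord: "continuous_on S (half_chord P)"
  unfolding half_chord_def by (intro continuous_intros continuous_on_circle_pt)

lemma continuous_on_exit_point: "continuous_on S (exit_point P)"
  unfolding exit_point_def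
  by (intro continuous_intros continuous_on_circle_pt continuous_on_half_chord)

lemma chord_integrand_bounded:
  assumes "continuous_on (sphere 0 1) \<phi>"
  obtains B where "\<And>P \<beta>. norm P \<le> 1 \<Longrightarrow> norm (chord_integrand \<phi> P \<beta>) \<le> B"
proof -
  have "bounded (\<phi> ` sphere 0 1)"
    using assms by (intro compact_imp_bounded compact_continuous_image) auto
  then obtain M where M: "\<And>x. x \<in> sphere 0 1 \<Longrightarrow> norm (\<phi> x) \<le> M"
    unfolding bounded_iff by blast
  have "norm (chord_integrand \<phi> P \<beta>) \<le> 2 * M" if "norm P \<le> 1" for P \<beta>
    unfolding chord_integrand_def norm_scaleR
    using that M[of "exit_point P \<beta>"] exit_weight_abs_le[OF that] norm_exit_point[OF that]
    by (intro mult_mono) auto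
  then show ?thesis by (rule that)
qed

lemma chord_integrand_integrable:
  assumes "continuous_on (sphere 0 1) \<phi>" "norm P \<le> 1"
  shows "chord_integrand \<phi> P integrable_on {a..b}"
proof -
  obtain B where B: "\<And>P \<beta>. norm P \<le> 1 \<Longrightarrow> norm (chord_integrand \<phi> P \<beta>) \<le> B"
    using chord_integrand_bounded[OF assms(1)] by blast
  have [measurable]: "circle_pt \<in> borel_measurable borel" "half_chord P \<in> borel_measurable borel"
    by (intro borel_measurable_continuous_onI continuous_on_circle_pt continuous_on_half_chord)+
  have "continuous_on UNIV (\<lambda>\<beta>. \<phi> (exit_point P \<beta>))"
    by (rule continuous_on_compose2[OF assms(1) continuous_on_exit_point])
       (auto simp: norm_exit_point[OF assms(2)])
  then have [measurable]: "(\<lambda>\<beta>. \<phi> (exit_point P \<beta>)) \<in> borel_measurable borel"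
    by (rule borel_measurable_continuous_onI)
  have "chord_integrand \<phi> P \<in> borel_measurable borel"
    unfolding chord_integrand_def exit_weight_def by measurable
  then have "chord_integrand \<phi> P \<in> borel_measurable (lebesgue_on {a..b})"
    by (intro measurable_restrict_space1 measurable_completion) simp
  then show ?thesis
    by (rule measurable_bounded_by_integrable_imp_integrable[where g = "\<lambda>_. B"])
       (use B assms(2) in auto)
qed

text \<open>
  The substitution \<open>\<beta> = \<theta> + \<alpha>\<close>, with \<open>\<alpha>\<close> the polar angle of \<open>P\<close>, moves the domain of integration
  by less than a full period and removes \<open>\<alpha>\<close> from the integrand.
\<close>

lemma ext_op_eq_chord_integral:
  assumes "continuous_on (sphere 0 1) \<phi>" "norm P \<le> 1"
  shows "ext_op \<phi> P = (1 / (2 * pi)) *\<^sub>R integral {0..2 * pi} (chord_integrand \<phi> P)"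
proof -
  let ?\<alpha> = "polar_angle P"
  have per: "chord_integrand \<phi> P (x + 2 * pi) = chord_integrand \<phi> P x" for x
    by (simp add: chord_integrand_def exit_weight_def exit_point_def half_chord_def
        circle_pt_add_2pi)
  have "integral {0..2 * pi} (\<lambda>\<theta>. kernel_k (norm P) \<theta> *\<^sub>R
            \<phi> (circle_pt (psi_star (norm P) \<theta> + ?\<alpha>))) =
        integral {0..2 * pi} (\<lambda>\<theta>. chord_integrand \<phi> P (\<theta> + ?\<alpha>))"
    \<comment> \<open>The two angles with zero cosine are those where the value of the kernel at radius 1 is a convention.\<close>
  proof (rule integral_spike[OF negligible_cos_zero[of 0]])
    fix \<theta> assume "\<theta> \<in> {0..2 * pi} - {x. cos (x - 0) = 0}"
    then show "chord_integrand \<phi> P (\<theta> + ?\<alpha>) = kernel_k (norm P) \<theta> *\<^sub>R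
            \<phi> (circle_pt (psi_star (norm P) \<theta> + ?\<alpha>))"
      using exit_weight_polar[of "norm P" \<theta> ?\<alpha>] exit_point_polar[of "norm P" \<theta> ?\<alpha>] assms(2)
      by (simp add: chord_integrand_def polar_angle_spec(3)[symmetric])
  qed
  also have "\<dots> = integral {0..2 * pi} (chord_integrand \<phi> P)"
    using polar_angle_spec(1,2)[of P]
    by (intro integral_periodic_shift chord_integrand_integrable assms per) auto
  finally show ?thesis by (simp add: ext_op_def)
qed

section \<open>Boundary values and continuity\<close>

text \<open>
  At a boundary point either the ray leaves at once, or the weight vanishes and the exit point is
  irrelevant. In a tangential direction the quotient \<open>0 / 0 = 0\<close> agrees with \<open>sgn 0 = 0\<close>.
\<close>

lemma chord_integrand_sphere:
  assumes "norm P = 1"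
  shows "chord_integrand \<phi> P \<beta> = (1 + sgn (P \<bullet> circle_pt \<beta>)) *\<^sub>R \<phi> P"
proof -
  let ?c = "P \<bullet> circle_pt \<beta>"
  have s: "half_chord P \<beta> = \<bar>?c\<bar>"
    using assms by (simp add: half_chord_def)
  have w: "exit_weight P \<beta> = 1 + sgn ?c"
    by (simp add: exit_weight_def s sgn_real_def abs_if)
  show ?thesis
  proof (cases "?c < 0")
    case True
    then show ?thesis by (simp add: chord_integrand_def w)
  next
    case False
    then have "exit_point P \<beta> = P" by (simp add: exit_point_def s)
    then show ?thesis by (simp add: chord_integrand_def w)
  qed
qed

lemma integral_half_period_antisym:
  fixes f :: "real \<Rightarrow> 'a::euclidean_space"
  assumes int: "\<And>a b. f integrable_on {a..b}"
    and anti: "\<And>x. f (x + c) = - f x" and c: "0 \<le> c"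
  shows "integral {0..2 * c} f = 0"
proof -
  have "f (x + 2 * c) = f x" for x
  proof -
    have "f (x + 2 * c) = f ((x + c) + c)" by (simp add: algebra_simps)
    then show ?thesis by (simp only: anti minus_minus)
  qed
  then have "integral {0..2 * c} (\<lambda>x. f (x + c)) = integral {0..2 * c} f"
    using c int by (intro integral_periodic_shift) auto
  then have "- integral {0..2 * c} f = integral {0..2 * c} f"
    by (simp only: anti integral_neg)
  then show ?thesis
    unfolding neg_eq_iff_add_eq_0 scaleR_2[symmetric] by simp
qed

lemma ext_op_sphere:
  assumes "continuous_on (sphere 0 1) \<phi>" "norm P = 1"
  shows "ext_op \<phi> P = \<phi> P"
proof -
  let ?g = "\<lambda>\<beta>. sgn (P \<bullet> circle_pt \<beta>) *\<^sub>R \<phi> P"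
  have dec: "chord_integrand \<phi> P = (\<lambda>\<beta>. \<phi> P + ?g \<beta>)"
    by (rule ext) (simp add: chord_integrand_sphere[OF assms(2)] scaleR_left_distrib)
  have "(\<lambda>\<beta>. chord_integrand \<phi> P \<beta> - \<phi> P) integrable_on {a..b}" for a b
    using assms by (intro integrable_diff chord_integrand_integrable) auto
  then have g: "?g integrable_on {a..b}" for a b by (simp add: dec)
  have "sgn (P \<bullet> circle_pt (\<beta> + pi)) = - sgn (P \<bullet> circle_pt \<beta>)" for \<beta>
    by (simp add: inner_circle_pt sgn_minus[symmetric] del: sgn_minus)
  then have zero: "integral {0..2 * pi} ?g = 0"
    by (intro integral_half_period_antisym g) auto
  have "integral {0..2 * pi} (chord_integrand \<phi> P) = (2 * pi) *\<^sub>R \<phi> P"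
    unfolding dec using g zero by (subst integral_add) auto
  then show ?thesis using assms by (simp add: ext_op_eq_chord_integral)
qed

text \<open>
  Discontinuities of the integrand as a function of \<open>P\<close> can only occur at zeros of the half chord:
  the tangential directions at boundary points.
\<close>

lemma half_chord_eq_0D:
  assumes "norm P \<le> 1" "half_chord P \<beta> = 0"
  shows "norm P = 1" "P \<bullet> circle_pt \<beta> = 0"
proof -
  show c: "P \<bullet> circle_pt \<beta> = 0"
    using abs_inner_le_half_chord[OF assms(1), of \<beta>] assms(2) by simp
  have "(norm P)\<^sup>2 = 1\<^sup>2"
    using assms(2) by (simp add: half_chord_def c)
  then show "norm P = 1" by (rule power2_eq_imp_eq) auto
qed

lemma negligible_half_chord_zero:
  assumes "norm P \<le> 1"
  shows "negligible {\<beta>. half_chord P \<beta> = 0}"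
proof (rule negligible_subset[OF negligible_cos_zero])
  show "{\<beta>. half_chord P \<beta> = 0} \<subseteq> {x. cos (x - polar_angle P) = 0}"
  proof clarify
    fix \<beta> assume zero: "half_chord P \<beta> = 0"
    have "P = circle_pt (polar_angle P)"
      using polar_angle_spec(3)[of P] half_chord_eq_0D(1)[OF assms zero] by simp
    then have "circle_pt (polar_angle P) \<bullet> circle_pt \<beta> = 0"
      using half_chord_eq_0D(2)[OF assms zero] by (rule subst)
    then show "cos (\<beta> - polar_angle P) = 0"
      by (simp only: inner_circle_pt_circle_pt)
  qed
qed

lemma chord_integrand_tendsto:
  assumes \<phi>: "continuous_on (sphere 0 1) \<phi>"
    and u: "\<And>n. norm (u n) \<le> 1" "u \<longlonglongrightarrow> P" and P: "norm P \<le> 1" "half_chord P \<beta> \<noteq> 0"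
  shows "(\<lambda>n. chord_integrand \<phi> (u n) \<beta>) \<longlonglongrightarrow> chord_integrand \<phi> P \<beta>"
proof -
  have s: "(\<lambda>n. half_chord (u n) \<beta>) \<longlonglongrightarrow> half_chord P \<beta>"
    unfolding half_chord_def by (intro tendsto_intros u)
  have "(\<lambda>n. exit_point (u n) \<beta>) \<longlonglongrightarrow> exit_point P \<beta>"
    unfolding exit_point_def by (intro tendsto_intros u s)
  then have "(\<lambda>n. \<phi> (exit_point (u n) \<beta>)) \<longlonglongrightarrow> \<phi> (exit_point P \<beta>)"
    by (rule continuous_on_tendsto_compose[OF \<phi>]) (auto simp: norm_exit_point u P)
  then show ?thesis
    unfolding chord_integrand_def exit_weight_def by (intro tendsto_intros u s P)
qed

text \<open>
  Along a sequence tending to \<open>P\<close> the exceptional angles to be discarded are those of the limit \<open>P\<close>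
  alone; the integrands of the sequence need only be integrable and uniformly bounded.
\<close>

lemma continuous_on_chord_integral:
  assumes \<phi>: "continuous_on (sphere 0 1) \<phi>"
  shows "continuous_on (cball 0 1) (\<lambda>P. integral {a..b} (chord_integrand \<phi> P))"
proof (rule continuous_on_sequentiallyI)
  fix u :: "nat \<Rightarrow> real ^ 2" and P
  assume "\<forall>n. u n \<in> cball 0 1" "P \<in> cball 0 1" and u: "u \<longlonglongrightarrow> P"
  then have un: "norm (u n) \<le> 1" and P: "norm P \<le> 1" for n by auto
  obtain B where B: "\<And>P \<beta>. norm P \<le> 1 \<Longrightarrow> norm (chord_integrand \<phi> P \<beta>) \<le> B"
    using chord_integrand_bounded[OF \<phi>] by blast
  let ?S = "{a..b} - {\<beta>. half_chord P \<beta> = 0}"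
  have neg: "negligible ({a..b} - ?S)"
    by (rule negligible_subset[OF negligible_half_chord_zero[OF P]]) auto
  have restrict: "f integrable_on ?S" if "f integrable_on {a..b}"
    for f :: "real \<Rightarrow> 'a::euclidean_space"
    using that by (rule integrable_spike_set) (auto intro: negligible_subset[OF neg])
  have drop: "integral ?S f = integral {a..b} f" for f :: "real \<Rightarrow> real ^ 2"
    by (rule integral_subset_negligible[OF _ neg]) auto
  have "(\<lambda>n. integral ?S (chord_integrand \<phi> (u n))) \<longlonglongrightarrow> integral ?S (chord_integrand \<phi> P)"
  proof (rule dominated_convergence(2)[where h = "\<lambda>_. B"])
    show "chord_integrand \<phi> (u n) integrable_on ?S" for n
      by (intro restrict chord_integrand_integrable \<phi> un)
    show "(\<lambda>_. B) integrable_on ?S" by (intro restrict) auto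
  qed (use B un u P in \<open>auto intro!: chord_integrand_tendsto[OF \<phi>]\<close>)
  then show "(\<lambda>n. integral {a..b} (chord_integrand \<phi> (u n))) \<longlonglongrightarrow>
      integral {a..b} (chord_integrand \<phi> P)"
    by (simp only: drop)
qed

theorem theorem9:
  fixes \<phi> :: "real ^ 2 \<Rightarrow> real ^ 2"
  assumes "continuous_on (sphere 0 1) \<phi>"
  shows "continuous_on (cball 0 1) (ext_op \<phi>) \<and>
         (\<forall>P \<in> sphere 0 1. ext_op \<phi> P = \<phi> P)"
proof
  have "continuous_on (cball 0 1)
      (\<lambda>P. (1 / (2 * pi)) *\<^sub>R integral {0..2 * pi} (chord_integrand \<phi> P))"
    by (intro continuous_intros continuous_on_chord_integral assms)
  then show "continuous_on (cball 0 1) (ext_op \<phi>)"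
    by (rule continuous_on_eq) (simp add: ext_op_eq_chord_integral[OF assms])
  show "\<forall>P \<in> sphere 0 1. ext_op \<phi> P = \<phi> P"
    using ext_op_sphere[OF assms] by simp
qed

end
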